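(* For positive integers $m_2,m_3,m_4$, \begin{align*} &\zeta\left(\overline{1},\overline{1},\{1\}_{m_2-1},2,\{1\}_{m_3-1},2,\{1\}_{m_4-1}\right)\\ &=\zeta\left(\overline{1},\overline{1},\{1\}_{m_4-1},\overline{1},\overline{1},\{1\}_{m_3-1},\overline{1},\overline{1},\{1\}_{m_2-1}\right)+\zeta\left(\overline{1},\overline{1},\{1\}_{m_2+m_3+m_4+1}\right)\\ &\quad-\zeta\left(\overline{1},\overline{1},\{1\}_{m_3+m_4},\overline{1},\overline{1},\{1\}_{m_2-1}\right)-\zeta\left(\overline{1},\overline{1},\{1\}_{m_4-1},\overline{1},\overline{1},\{1\}_{m_2+m_3}\right)\\ &\quad+\zeta\left(\overline{1},\overline{1},\{1\}_{m_2-1},2,\{1\}_{m_3-1}\right)\zeta(m_4+1)\\ &\quad-\zeta\left(\overline{1},\overline{1},\{1\}_{m_2-1}\right)\left(\zeta(m_3+m_4+2)+\zeta(m_3+1,m_4+1)\right). \end{align*}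
   Context: Alternating MZVs: for nonzero integers $s_j$ (overlined $\overline{s}$ means $-s$), $\zeta(s_1,\dots,s_k)=\sum_{n_1>\cdots>n_k\ge1}\prod_j\mathrm{sgn}(s_j)^{n_j}n_j^{-|s_j|}$ (convergent whenever $s_1\ne1$). $\{1\}_d$ denotes $d$ consecutive entries equal to $1$, empty if $d=0$. *)

theory Defs
  imports "HOL-Analysis.Analysis"
begin

definition amzv_indices :: "nat \<Rightarrow> nat \<Rightarrow> nat list set" where
  "amzv_indices k N = {ns. length ns = k \<and> sorted_wrt (>) ns \<and> set ns \<subseteq> {1..N}}"

definition amzv_term :: "int list \<Rightarrow> nat list \<Rightarrow> real" where
  "amzv_term s ns =
     (\<Prod>j<length s. of_int (sgn (s ! j)) ^ (ns ! j) / real (ns ! j) ^ nat \<bar>s ! j\<bar>)"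

text \<open>
  The defining series is in general only conditionally convergent (when the leading argument is
  \<open>-1\<close>), so its value is the limit of the partial sums over \<open>N \<ge> n\<^sub>1 > \<dots> > n\<^sub>k \<ge> 1\<close>.
  An overlined argument is encoded as a negative integer.
\<close>

definition amzv :: "int list \<Rightarrow> real" where
  "amzv s = lim (\<lambda>N. \<Sum>ns\<in>amzv_indices (length s) N. amzv_term s ns)"

abbreviation ones :: "nat \<Rightarrow> int list" where
  "ones d \<equiv> replicate d 1"

end

theory Submission
  imports Defs
begin

text \<open>
  Substituting \<open>t = 1 - exp (- x)\<close> in the iterated integral representation, the three differential
  forms \<open>dt/(1 - t)\<close>, \<open>dt/(1 + t)\<close>, \<open>dt/t\<close> become \<open>dx\<close>, \<open>dx/(2 exp x - 1)\<close>, \<open>dx/(exp x - 1)\<close>. Let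
  \<open>L f k\<close> be the integral of \<open>exp (- k x) f x\<close> over \<open>[0, \<infinity>)\<close>. If \<open>f 0 = 0\<close> then \<open>L f k = L f' k / k\<close>,
  and expanding the last two forms geometrically gives \<open>L (h / (r exp x - 1)) k = \<Sum>\<^sub>j\<^sub>>\<^sub>k r\<^sup>k\<^sup>-\<^sup>j L h j\<close>.
  So every alternating value in the theorem is, up to sign, a multiple sum over positive terms.
  With \<open>p\<^sub>i = m\<^sub>i + 1\<close>, the left-hand side is minus the sum of \<open>2\<^sup>-\<^sup>n n\<^sup>-\<^sup>p\<^sup>2 k\<^sup>-\<^sup>p\<^sup>3 l\<^sup>-\<^sup>p\<^sup>4\<close> over \<open>n < k < l\<close>, while
  the first four terms on the right add up to minus the sum of the same terms over \<open>n \<ge> k \<ge> l\<close>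
  (split according to which of the inequalities are strict). Inclusion-exclusion on the two
  inequalities produces the remaining products.
\<close>

section \<open>Coefficients of the defining series\<close>

text \<open>\<open>amzv_coeff s n\<close> collects the terms of the series with largest index \<open>n\<^sub>1 = n\<close>.\<close>

fun amzv_coeff :: "int list \<Rightarrow> nat \<Rightarrow> real" where
  "amzv_coeff [] n = (if n = 0 then 1 else 0)"
| "amzv_coeff (s # ss) n = of_int (sgn s) ^ n / real n ^ nat \<bar>s\<bar> * (\<Sum>k<n. amzv_coeff ss k)"

lemma amzv_indices_0: "amzv_indices 0 N = {[]}"
  by (auto simp: amzv_indices_def)

lemma finite_amzv_indices: "finite (amzv_indices k N)"
proof (rule finite_subset)
  show "amzv_indices k N \<subseteq> {ns. set ns \<subseteq> {1..N} \<and> length ns = k}"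
    by (auto simp: amzv_indices_def)
qed (rule finite_lists_length_eq, simp)

lemma amzv_indices_Suc:
  "amzv_indices (Suc k) N = (\<Union>n\<in>{1..N}. (#) n ` amzv_indices k (n - 1))"
proof (intro set_eqI iffI)
  fix ns assume "ns \<in> amzv_indices (Suc k) N"
  then obtain n ms where "ns = n # ms" "length ms = k" "sorted_wrt (>) ms" "\<forall>m\<in>set ms. m < n"
      "set ms \<subseteq> {1..N}" "n \<in> {1..N}"
    by (auto simp: amzv_indices_def length_Suc_conv)
  moreover from this have "ms \<in> amzv_indices k (n - 1)"
    by (fastforce simp: amzv_indices_def)
  ultimately show "ns \<in> (\<Union>n\<in>{1..N}. (#) n ` amzv_indices k (n - 1))"
    by blast
qed (force simp: amzv_indices_def)

text \<open>Fixing the largest index n leaves tuples bounded by n - 1, which is the recursion of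
  \<open>amzv_coeff\<close>. The empty list puts its mass at index 0, below every admissible
  index.\<close>

lemma sum_amzv_indices:
  "(\<Sum>ns\<in>amzv_indices (length s) N. amzv_term s ns) = (\<Sum>k\<le>N. amzv_coeff s k)"
proof (induction s arbitrary: N)
  case Nil
  show ?case by (simp add: amzv_indices_0 amzv_term_def sum.delta)
next
  case (Cons s ss)
  have "(\<Sum>ns\<in>amzv_indices (length (s # ss)) N. amzv_term (s # ss) ns)
      = (\<Sum>n\<in>{1..N}. \<Sum>ns\<in>(#) n ` amzv_indices (length ss) (n - 1). amzv_term (s # ss) ns)"
    unfolding length_Cons amzv_indices_Suc
    by (rule sum.UNION_disjoint) (auto simp: finite_amzv_indices)
  also have "\<dots> = (\<Sum>n\<in>{1..N}. amzv_coeff (s # ss) n)"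
  proof (rule sum.cong[OF refl])
    fix n assume n: "n \<in> {1..N}"
    have "(\<Sum>ns\<in>(#) n ` amzv_indices (length ss) (n - 1). amzv_term (s # ss) ns)
       = (\<Sum>ms\<in>amzv_indices (length ss) (n - 1). amzv_term (s # ss) (n # ms))"
      by (subst sum.reindex) auto
    also have "\<dots> = (\<Sum>ms\<in>amzv_indices (length ss) (n - 1).
        of_int (sgn s) ^ n / real n ^ nat \<bar>s\<bar> * amzv_term ss ms)"
      by (simp add: amzv_term_def prod.lessThan_Suc_shift del: prod.lessThan_Suc)
    also have "\<dots> = of_int (sgn s) ^ n / real n ^ nat \<bar>s\<bar> * (\<Sum>k\<le>n - 1. amzv_coeff ss k)"
      unfolding sum_distrib_left[symmetric] Cons.IH ..
    also have "{..n - 1} = {..<n}" using n by auto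
    finally show "(\<Sum>ns\<in>(#) n ` amzv_indices (length ss) (n - 1). amzv_term (s # ss) ns)
       = amzv_coeff (s # ss) n" by simp
  qed
  \<comment> \<open>The added term n = 0 vanishes because its inner sum is empty.\<close>
  also have "\<dots> = (\<Sum>n\<le>N. amzv_coeff (s # ss) n)"
    by (rule sum.mono_neutral_left) auto
  finally show ?case .
qed

text \<open>\<open>lim\<close> and \<open>suminf\<close> are definite descriptions of equivalent
  predicates, so they agree whether or not the series converges.\<close>

lemma amzv_eq_suminf: "amzv s = suminf (amzv_coeff s)"
proof -
  have "amzv_coeff s sums x \<longleftrightarrow> (\<lambda>N. \<Sum>k\<le>N. amzv_coeff s k) \<longlonglongrightarrow> x" for x
    by (rule sums_def_le)
  then show ?thesis
    by (simp add: amzv_def sum_amzv_indices lim_def suminf_def)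
qed

section \<open>Growth of partial sums and convergence for leading argument -1\<close>

lemma sum_inverse_sqrt_le: "(\<Sum>k\<le>n. 1 / sqrt (real k)) \<le> 2 * sqrt (real n)"
proof (induction n)
  case (Suc n)
  define x y where "x = sqrt (real n)" and "y = sqrt (real (Suc n))"
  have xy: "0 \<le> x" "x \<le> y" "0 < y" "y * y = x * x + 1"
    by (auto simp: x_def y_def)
  have "1 = (y - x) * (y + x)" using xy by (simp add: algebra_simps)
  also have "\<dots> \<le> (y - x) * (2 * y)" using xy by (intro mult_left_mono) auto
  finally have "1 / y \<le> 2 * (y - x)" using xy by (simp add: field_simps)
  with Suc show ?case by (simp add: x_def y_def del: of_nat_Suc)
qed simp

text \<open>The sign has absolute value 1, and the exponent is at least 1 because the entry is
  nonzero.\<close>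

lemma abs_amzv_coeff_Cons_le:
  assumes "s \<noteq> 0"
  shows "\<bar>amzv_coeff (s # ss) n\<bar> \<le> \<bar>\<Sum>k<n. amzv_coeff ss k\<bar> / real n"
proof (cases "n = 0")
  case False
  have "real n ^ 1 \<le> real n ^ nat \<bar>s\<bar>"
    using assms False by (intro power_increasing) auto
  then have "\<bar>\<Sum>k<n. amzv_coeff ss k\<bar> / real n ^ nat \<bar>s\<bar> \<le> \<bar>\<Sum>k<n. amzv_coeff ss k\<bar> / real n"
    using False by (intro divide_left_mono) auto
  moreover have "\<bar>real_of_int (sgn s) ^ n\<bar> = 1"
    using assms by (simp add: power_abs sgn_if)
  ultimately show ?thesis
    by (simp add: abs_mult)
qed auto

text \<open>This uniform bound makes the associated power series converge on (-1, 1).\<close>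

lemma abs_amzv_coeff_le_1:
  assumes "0 \<notin> set s"
  shows "\<bar>amzv_coeff s n\<bar> \<le> 1"
  using assms
proof (induction s arbitrary: n)
  case (Cons s ss)
  have "\<bar>\<Sum>k<n. amzv_coeff ss k\<bar> \<le> real n * 1"
    using Cons sum_norm_bound[of "{..<n}" "amzv_coeff ss" 1] by simp
  then have "\<bar>\<Sum>k<n. amzv_coeff ss k\<bar> / real n \<le> 1"
    by (cases "n = 0") auto
  then show ?case
    using abs_amzv_coeff_Cons_le[of s ss n] Cons.prems by simp
qed simp

text \<open>The square root is a crude bound that reproduces itself under the recursion: dividing by
  k leaves 1 / sqrt k, and summing this again costs only a factor 2 per entry.\<close>

lemma abs_sum_amzv_coeff_le:
  assumes "0 \<notin> set s"
  shows "\<bar>\<Sum>k<n. amzv_coeff s k\<bar> \<le> 2 ^ length s * sqrt (real n)"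
  using assms
proof (induction s arbitrary: n)
  case Nil
  show ?case by (cases n) (auto simp: sum.delta)
next
  case (Cons s ss)
  have "\<bar>amzv_coeff (s # ss) k\<bar> \<le> 2 ^ length ss * (1 / sqrt (real k))" for k
  proof -
    have "\<bar>amzv_coeff (s # ss) k\<bar> \<le> \<bar>\<Sum>j<k. amzv_coeff ss j\<bar> / real k"
      using Cons.prems by (intro abs_amzv_coeff_Cons_le) auto
    also have "\<dots> \<le> 2 ^ length ss * sqrt (real k) / real k"
      using Cons by (intro divide_right_mono) auto
    also have "\<dots> = 2 ^ length ss * (1 / sqrt (real k))"
      by (cases "k = 0") (auto simp: field_simps)
    finally show ?thesis .
  qed
  then have "(\<Sum>k<n. \<bar>amzv_coeff (s # ss) k\<bar>) \<le> (\<Sum>k<n. 2 ^ length ss * (1 / sqrt (real k)))"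
    by (rule sum_mono)
  also have "\<dots> \<le> (\<Sum>k\<le>n. 2 ^ length ss * (1 / sqrt (real k)))"
    by (rule sum_mono2) auto
  also have "\<dots> = 2 ^ length ss * (\<Sum>k\<le>n. 1 / sqrt (real k))"
    by (rule sum_distrib_left[symmetric])
  also have "\<dots> \<le> 2 ^ length ss * (2 * sqrt (real n))"
    by (intro mult_left_mono sum_inverse_sqrt_le) auto
  finally show ?case
    using sum_abs[of "amzv_coeff (s # ss)" "{..<n}"] by simp
qed

text \<open>Summation by parts: twice a partial sum is a partial sum of an absolutely convergent
  series plus boundary terms, of which the one at N tends to 0.\<close>

lemma summable_alternating_bounded_variation:
  fixes u :: "nat \<Rightarrow> real"
  assumes "u \<longlonglongrightarrow> 0" and "summable (\<lambda>n. \<bar>u (Suc n) - u n\<bar>)"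
  shows "summable (\<lambda>n. (-1) ^ n * u n)"
proof -
  have "summable (\<lambda>n. (-1) ^ n * (u n - u (Suc n)))"
    by (rule summable_norm_cancel, rule summable_cong[THEN iffD1, OF _ assms(2)])
       (simp add: abs_mult power_abs abs_minus_commute)
  then have lim: "convergent (\<lambda>N. \<Sum>n<N. (-1) ^ n * (u n - u (Suc n)))"
    by (simp add: summable_iff_convergent)
  have eq: "(\<Sum>n<N. (-1) ^ n * u n)
      = ((\<Sum>n<N. (-1) ^ n * (u n - u (Suc n))) + u 0 - (-1) ^ N * u N) / 2" for N
    by (induction N) (auto simp: field_simps)
  have "(\<lambda>N. (-1) ^ N * u N) \<longlonglongrightarrow> 0"
    by (rule tendsto_rabs_zero_cancel) (simp add: abs_mult power_abs tendsto_rabs_zero assms(1))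
  moreover obtain L where "(\<lambda>N. \<Sum>n<N. (-1) ^ n * (u n - u (Suc n))) \<longlonglongrightarrow> L"
    using lim by (auto simp: convergent_def)
  ultimately have "(\<lambda>N. \<Sum>n<N. (-1) ^ n * u n) \<longlonglongrightarrow> (L + u 0 - 0) / 2"
    unfolding eq by (intro tendsto_divide tendsto_diff tendsto_add tendsto_const) auto
  then show ?thesis
    by (auto simp: summable_iff_convergent convergent_def)
qed

text \<open>The coefficients are (-1)^n times the averages \<open>u n\<close> of the coefficients of
  the remaining list. These averages are O(n^(-1/2)) and their increments are O(n^(-3/2)), so they
  have bounded variation.\<close>

lemma summable_amzv_coeff_minus_one:
  assumes "0 \<notin> set s"
  shows "summable (amzv_coeff (- 1 # s))"
proof -
  define u where "u n = (\<Sum>k<n. amzv_coeff s k) / real n" for n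
  define C :: real where "C = 2 ^ length s"
  have A: "\<bar>\<Sum>k<n. amzv_coeff s k\<bar> \<le> C * sqrt (real n)" for n
    unfolding C_def by (rule abs_sum_amzv_coeff_le[OF assms])
  have c: "\<bar>amzv_coeff s n\<bar> \<le> C / sqrt (real n)" if "n \<ge> 1" for n
  proof (cases s)
    case Nil
    then show ?thesis using that by (simp add: C_def)
  next
    case (Cons t ss)
    have "\<bar>amzv_coeff s n\<bar> \<le> \<bar>\<Sum>k<n. amzv_coeff ss k\<bar> / real n"
      using assms unfolding Cons by (intro abs_amzv_coeff_Cons_le) auto
    also have "\<dots> \<le> 2 ^ length ss * sqrt (real n) / real n"
      using assms Cons by (intro divide_right_mono abs_sum_amzv_coeff_le) auto
    also have "\<dots> = 2 ^ length ss / sqrt (real n)"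
      using that by (simp add: field_simps)
    also have "\<dots> \<le> C / sqrt (real n)"
      unfolding C_def Cons by (intro divide_right_mono) auto
    finally show ?thesis .
  qed
  have u_le: "\<bar>u n\<bar> \<le> C / sqrt (real n)" for n
  proof -
    have "\<bar>u n\<bar> \<le> C * sqrt (real n) / real n"
      unfolding u_def abs_divide abs_of_nat by (intro divide_right_mono A) auto
    also have "\<dots> = C / sqrt (real n)"
      by (cases "n = 0") (auto simp: field_simps)
    finally show ?thesis .
  qed
  have "u \<longlonglongrightarrow> 0"
  proof (rule Lim_null_comparison)
    show "\<forall>\<^sub>F n in sequentially. norm (u n) \<le> C / sqrt (real n)"
      using u_le by simp
    show "(\<lambda>n. C / sqrt (real n)) \<longlonglongrightarrow> 0"
      by (intro tendsto_divide_0[OF tendsto_const] filterlim_at_top_imp_at_infinity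
            filterlim_compose[OF sqrt_at_top] filterlim_real_sequentially)
  qed
  moreover have "summable (\<lambda>n. \<bar>u (Suc n) - u n\<bar>)"
  proof (rule summable_comparison_test_ev)
    have "\<bar>u (Suc n) - u n\<bar> \<le> 2 * C * (1 / real n powr (3/2))" if "n \<ge> 1" for n
    proof -
      \<comment> \<open>Passing from n to n + 1 adds one coefficient to the sum and enlarges the
        denominator by 1. Both resulting terms are bounded by C / sqrt n.\<close>
      have "u (Suc n) - u n = (amzv_coeff s n - u n) / (real n + 1)"
        using that by (simp add: u_def field_simps)
      then have "\<bar>u (Suc n) - u n\<bar> \<le> (\<bar>amzv_coeff s n\<bar> + \<bar>u n\<bar>) / (real n + 1)"
        by (simp add: divide_right_mono)
      also have "\<dots> \<le> (2 * C / sqrt (real n)) / (real n + 1)"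
        using c[OF that] u_le[of n] by (intro divide_right_mono) auto
      also have "\<dots> \<le> (2 * C / sqrt (real n)) / real n"
        using that by (intro divide_left_mono) (auto simp: C_def)
      also have "\<dots> = 2 * C * (1 / real n powr (3/2))"
      proof -
        have "real n powr (3/2) = real n powr (1 + 1/2)" by simp
        also have "\<dots> = real n * sqrt (real n)"
          by (subst powr_add) (simp add: powr_half_sqrt)
        finally show ?thesis by simp
      qed
      finally show ?thesis .
    qed
    then show "\<forall>\<^sub>F n in sequentially. norm \<bar>u (Suc n) - u n\<bar> \<le> 2 * C * (1 / real n powr (3/2))"
      by (auto simp: eventually_at_top_linorder)
    show "summable (\<lambda>n. 2 * C * (1 / real n powr (3/2)))"
      by (intro summable_mult) (simp add: summable_real_powr_iff powr_minus_divide[symmetric])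
  qed
  ultimately have "summable (\<lambda>n. (-1) ^ n * u n)"
    by (rule summable_alternating_bounded_variation)
  moreover have "amzv_coeff (- 1 # s) = (\<lambda>n. (-1) ^ n * u n)"
    by (auto simp: u_def fun_eq_iff)
  ultimately show ?thesis
    by simp
qed

subsection \<open>Power series with bounded coefficients\<close>

definition powser :: "(nat \<Rightarrow> real) \<Rightarrow> real \<Rightarrow> real" where
  "powser c t = (\<Sum>n. c n * t ^ n)"

lemma summable_powser_bounded:
  fixes t :: real
  assumes "\<And>n. \<bar>c n\<bar> \<le> M" and "\<bar>t\<bar> < 1"
  shows "summable (\<lambda>n. \<bar>c n * t ^ n\<bar>)" and "summable (\<lambda>n. c n * t ^ n)"
proof -
  show "summable (\<lambda>n. \<bar>c n * t ^ n\<bar>)"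
  proof (rule summable_comparison_test')
    show "summable (\<lambda>n. M * \<bar>t\<bar> ^ n)"
      using assms by (intro summable_mult summable_geometric) auto
    show "norm \<bar>c n * t ^ n\<bar> \<le> M * \<bar>t\<bar> ^ n" if "n \<ge> 0" for n
      using assms(1)[of n] by (simp add: abs_mult power_abs mult_right_mono)
  qed
  then show "summable (\<lambda>n. c n * t ^ n)"
    by (rule summable_rabs_cancel)
qed

text \<open>Cauchy product with the geometric series.\<close>

lemma powser_partial_sums:
  assumes "\<And>n. \<bar>c n\<bar> \<le> M" and "\<bar>t\<bar> < 1"
  shows "(\<lambda>n. (\<Sum>k\<le>n. c k) * t ^ n) sums (powser c t / (1 - t))"
proof -
  have "(\<lambda>n. \<Sum>k\<le>n. (c k * t ^ k) * t ^ (n - k)) sums (powser c t * (\<Sum>n. t ^ n))"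
    unfolding powser_def
    using summable_powser_bounded(1)[OF assms] assms(2)
    by (intro Cauchy_product_sums) (auto simp: power_abs)
  moreover have "(\<Sum>k\<le>n. (c k * t ^ k) * t ^ (n - k)) = (\<Sum>k\<le>n. c k) * t ^ n" for n
    unfolding sum_distrib_right
    by (intro sum.cong) (simp_all add: mult.assoc flip: power_add)
  moreover have "(\<Sum>n. t ^ n) = 1 / (1 - t)"
    using assms(2) by (intro suminf_geometric) auto
  ultimately show ?thesis by simp
qed

text \<open>The difference \<open>powser c t - T\<close> is (1 - t) times the power series with
  coefficients \<open>S n - T\<close>. The first N coefficients contribute at most (1 - t) K, which
  vanishes in the limit, and the rest at most e / 2.\<close>

lemma Abel_limit_theorem:
  assumes "summable c"
  shows "(powser c \<longlongrightarrow> suminf c) (at_left 1)"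
proof (rule tendstoI)
  fix e :: real assume e: "e > 0"
  define T S where "T = suminf c" and "S n = (\<Sum>k\<le>n. c k)" for n
  have "c \<longlonglongrightarrow> 0" using assms by (rule summable_LIMSEQ_zero)
  then obtain M where M: "\<And>n. \<bar>c n\<bar> \<le> M"
    using convergent_imp_Bseq[of c] by (auto simp: convergent_def Bseq_def)
  have "S \<longlonglongrightarrow> T"
    unfolding S_def T_def using assms by (rule summable_LIMSEQ')
  then obtain N where N: "\<And>n. n \<ge> N \<Longrightarrow> \<bar>S n - T\<bar> < e / 2"
    using e by (metis LIMSEQ_D half_gt_zero real_norm_def)
  define K where "K = (\<Sum>n<N. \<bar>S n - T\<bar>)"
  have K: "K \<ge> 0" unfolding K_def by (intro sum_nonneg) auto
  have bound: "\<bar>powser c t - T\<bar> \<le> (1 - t) * K + e / 2" if t: "0 < t" "t < 1" for t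
  proof -
    have "(\<lambda>n. S n * t ^ n - T * t ^ n) sums (powser c t / (1 - t) - T * (1 / (1 - t)))"
      unfolding S_def using t
      by (intro sums_diff sums_mult powser_partial_sums[OF M] geometric_sums) auto
    then have sums: "(\<lambda>n. (S n - T) * t ^ n) sums ((powser c t - T) / (1 - t))"
      by (simp add: algebra_simps diff_divide_distrib)
    have "(\<lambda>n. (if n \<in> {..<N} then \<bar>S n - T\<bar> else 0) + e / 2 * t ^ n) sums (K + e / 2 * (1 / (1 - t)))"
      unfolding K_def using t
      by (intro sums_add sums_If_finite_set sums_mult geometric_sums) auto
    moreover have le: "\<bar>(S n - T) * t ^ n\<bar> \<le> (if n \<in> {..<N} then \<bar>S n - T\<bar> else 0) + e / 2 * t ^ n" for n
    proof (cases "n < N")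
      case True
      have "\<bar>S n - T\<bar> * t ^ n \<le> \<bar>S n - T\<bar> * 1"
        using t by (intro mult_left_mono power_le_one) auto
      moreover have "0 \<le> e / 2 * t ^ n"
        using e t by simp
      ultimately show ?thesis
        using True t by (simp add: abs_mult)
    next
      case False
      then show ?thesis
        using N[of n] t by (simp add: abs_mult mult_right_mono)
    qed
    ultimately have "\<bar>(powser c t - T) / (1 - t)\<bar> \<le> K + e / 2 * (1 / (1 - t))"
      using sums norm_suminf_le[of "\<lambda>n. (S n - T) * t ^ n"
          "\<lambda>n. (if n \<in> {..<N} then \<bar>S n - T\<bar> else 0) + e / 2 * t ^ n"]
      by (simp add: sums_iff)
    then have "(1 - t) * \<bar>(powser c t - T) / (1 - t)\<bar> \<le> (1 - t) * (K + e / 2 * (1 / (1 - t)))"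
      using t by (intro mult_left_mono) auto
    also have "\<dots> = (1 - t) * K + e / 2"
      using t by (simp only: distrib_left mult.left_commute[of "1 - t"]) simp
    finally show ?thesis
      using t by (simp add: abs_divide)
  qed
  have "((\<lambda>t. (1 - t) * K + e / 2) \<longlongrightarrow> (1 - 1) * K + e / 2) (at_left 1)"
    by (intro tendsto_intros)
  then have "\<forall>\<^sub>F t in at_left 1. (1 - t) * K + e / 2 < e"
    using e by (intro order_tendstoD(2)[where y = "(1 - 1) * K + e / 2"]) auto
  moreover have "\<forall>\<^sub>F t :: real in at_left 1. t \<in> {0<..<1}"
    by (rule eventually_at_left_real) simp
  ultimately show "\<forall>\<^sub>F t in at_left 1. dist (powser c t) (suminf c) < e"
  proof eventually_elim
    case (elim t)
    then show ?case using bound[of t] by (simp add: dist_real_def T_def)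
  qed
qed

text \<open>Prepending a unit entry \<epsilon> is integration of a differential form in t:
  differentiating cancels 1 / n, and the index shift turns the sum over k < n into one over k \<le>
  n.\<close>

lemma powser_has_derivative_step:
  fixes \<epsilon> t :: real
  assumes c: "\<And>n. \<bar>c n\<bar> \<le> 1" and t: "\<bar>t\<bar> < 1" and \<epsilon>: "\<bar>\<epsilon>\<bar> = 1"
  defines "b \<equiv> \<lambda>n. \<epsilon> ^ n / real n * (\<Sum>k<n. c k)"
  shows "\<bar>b n\<bar> \<le> 1"
    and "(powser b has_field_derivative \<epsilon> / (1 - \<epsilon> * t) * powser c (\<epsilon> * t)) (at t)"
proof -
  show b: "\<bar>b n\<bar> \<le> 1" for n
  proof -
    have "\<bar>\<Sum>k<n. c k\<bar> \<le> real n * 1"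
      using c sum_norm_bound[of "{..<n}" c 1] by simp
    then show ?thesis
      using \<epsilon> by (cases "n = 0") (auto simp: b_def abs_mult power_abs)
  qed
  have "(powser b has_field_derivative (\<Sum>n. diffs b n * t ^ n)) (at t)"
    unfolding powser_def[abs_def]
    using t summable_powser_bounded(2)[of b 1] b by (intro termdiffs_strong'[where K = 1]) auto
  moreover have "diffs b n * t ^ n = \<epsilon> * ((\<Sum>k\<le>n. c k) * (\<epsilon> * t) ^ n)" for n
    by (simp add: diffs_def b_def power_mult_distrib lessThan_Suc_atMost add.commute
        del: sum.lessThan_Suc)
  moreover have "(\<lambda>n. \<epsilon> * ((\<Sum>k\<le>n. c k) * (\<epsilon> * t) ^ n)) sums (\<epsilon> * (powser c (\<epsilon> * t) / (1 - \<epsilon> * t)))"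
    using c t \<epsilon> by (intro sums_mult powser_partial_sums[of c 1]) (auto simp: abs_mult)
  ultimately show "(powser b has_field_derivative \<epsilon> / (1 - \<epsilon> * t) * powser c (\<epsilon> * t)) (at t)"
    by (simp add: sums_iff)
qed

text \<open>Dividing coefficients by n is integration against dt/t. The derivative is given by
  shifted coefficients rather than as a quotient, so that it also makes sense at t = 0.\<close>

lemma powser_has_derivative_div:
  fixes t :: real
  assumes c: "\<And>n. \<bar>c n\<bar> \<le> 1" and t: "\<bar>t\<bar> < 1" and c0: "c 0 = 0"
  defines "b \<equiv> \<lambda>n. c n / real n"
  shows "\<bar>b n\<bar> \<le> 1"
    and "(powser b has_field_derivative powser (\<lambda>n. c (Suc n)) t) (at t)"
    and "t * powser (\<lambda>n. c (Suc n)) t = powser c t"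
proof -
  show b: "\<bar>b n\<bar> \<le> 1" for n
    using c[of n] by (cases "n = 0") (auto simp: b_def divide_le_eq)
  have "(powser b has_field_derivative (\<Sum>n. diffs b n * t ^ n)) (at t)"
    unfolding powser_def[abs_def]
    using t summable_powser_bounded(2)[of b 1] b by (intro termdiffs_strong'[where K = 1]) auto
  moreover have "diffs b n = c (Suc n)" for n
    by (simp add: diffs_def b_def del: of_nat_Suc)
  ultimately show "(powser b has_field_derivative powser (\<lambda>n. c (Suc n)) t) (at t)"
    by (simp add: powser_def)
  have "powser c t = (\<Sum>n. c (Suc n) * t ^ Suc n)"
    unfolding powser_def using summable_powser_bounded(2)[OF c t] c0
    by (subst suminf_split_head) auto
  also have "\<dots> = (\<Sum>n. t * (c (Suc n) * t ^ n))"
    by (simp add: mult_ac)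
  also have "\<dots> = t * powser (\<lambda>n. c (Suc n)) t"
    unfolding powser_def using summable_powser_bounded(2)[of "\<lambda>n. c (Suc n)" 1 t] c t
    by (subst suminf_mult) auto
  finally show "t * powser (\<lambda>n. c (Suc n)) t = powser c t" ..
qed

lemma powser_measurable [measurable]: "powser c \<in> borel_measurable borel"
  unfolding powser_def[abs_def] by measurable

subsection \<open>Laplace transforms at integers\<close>

text \<open>Since \<open>ennreal\<close> sends negative numbers to 0, this is the true Laplace
  transform only for functions that are nonnegative on the half-line.\<close>

definition laplace :: "(real \<Rightarrow> real) \<Rightarrow> nat \<Rightarrow> ennreal" where
  "laplace f k = (\<integral>\<^sup>+x. ennreal (exp (- (real k * x)) * f x) * indicator {0..} x \<partial>lborel)"

lemma nn_integral_exp_atLeast: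
  fixes k :: real
  assumes "k > 0"
  shows "(\<integral>\<^sup>+x. ennreal (exp (- (k * x))) * indicator {y..} x \<partial>lborel) = ennreal (exp (- (k * y)) / k)"
proof -
  have "((\<lambda>x. - exp (- (k * x)) / k) \<longlongrightarrow> - 0 / k) at_top"
    using assms
    by (intro tendsto_intros filterlim_compose[OF exp_at_bot] filterlim_uminus_at_bot_at_top[THEN filterlim_compose]
        filterlim_tendsto_pos_mult_at_top[OF tendsto_const] filterlim_ident) auto
  then have "(\<integral>\<^sup>+x. ennreal (exp (- (k * x))) * indicator {y..} x \<partial>lborel)
      = ennreal (- 0 / k - (- exp (- (k * y)) / k))"
    using assms
    by (intro nn_integral_FTC_atLeast) (auto intro!: derivative_eq_intros)
  then show ?thesis by simp
qed

text \<open>Write H x as the integral of h over [0, x] and apply Tonelli: the integral of exp (- k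
  x) over x \<ge> y is exp (- k y) / k.\<close>

lemma laplace_derivative:
  assumes [measurable]: "h \<in> borel_measurable borel"
    and deriv: "\<And>x. 0 \<le> x \<Longrightarrow> (H has_field_derivative h x) (at x)"
    and nonneg: "\<And>x. 0 \<le> x \<Longrightarrow> 0 \<le> h x" and H0: "H 0 = 0" and k: "k \<ge> 1"
  shows "laplace H k = ennreal (1 / real k) * laplace h k"
proof -
  have H: "ennreal (H x) = (\<integral>\<^sup>+y. ennreal (h y) * indicator {0..x} y \<partial>lborel)" if "0 \<le> x" for x
    by (subst nn_integral_FTC_Icc[where F = H]) (auto simp: deriv nonneg H0 that)
  have [measurable]: "(\<lambda>(x, y). indicator {0..x::real} y :: ennreal) \<in> borel_measurable (borel \<Otimes>\<^sub>M borel)"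
  proof -
    have "(\<lambda>(x, y). indicator {0..x} y :: ennreal) = (\<lambda>(x, y). if 0 \<le> y \<and> y \<le> (x::real) then 1 else 0)"
      by (auto simp: fun_eq_iff)
    moreover have "(\<lambda>(x, y). if 0 \<le> y \<and> y \<le> (x::real) then 1 else 0 :: ennreal)
        \<in> borel_measurable (borel \<Otimes>\<^sub>M borel)"
      by measurable
    ultimately show ?thesis by (simp only:)
  qed
  have "laplace H k = (\<integral>\<^sup>+x. (\<integral>\<^sup>+y. ennreal (exp (- (real k * x))) * indicator {0..} x *
      (ennreal (h y) * indicator {0..x} y) \<partial>lborel) \<partial>lborel)"
    unfolding laplace_def
  proof (rule nn_integral_cong)
    fix x :: real
    show "ennreal (exp (- (real k * x)) * H x) * indicator {0..} x =
      (\<integral>\<^sup>+y. ennreal (exp (- (real k * x))) * indicator {0..} x * (ennreal (h y) * indicator {0..x} y) \<partial>lborel)"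
      by (subst nn_integral_cmult)
         (auto simp: H[symmetric] ennreal_mult' split: split_indicator)
  qed
  also have "\<dots> = (\<integral>\<^sup>+y. (\<integral>\<^sup>+x. ennreal (exp (- (real k * x))) * indicator {0..} x *
      (ennreal (h y) * indicator {0..x} y) \<partial>lborel) \<partial>lborel)"
    by (rule lborel_pair.Fubini') measurable
  \<comment> \<open>Both pairs of indicators describe the region 0 \<le> y \<le> x.\<close>
  also have "\<dots> = (\<integral>\<^sup>+y. (\<integral>\<^sup>+x. (ennreal (h y) * indicator {0..} y) *
      (ennreal (exp (- (real k * x))) * indicator {y..} x) \<partial>lborel) \<partial>lborel)"
    by (intro nn_integral_cong) (auto simp: mult.commute split: split_indicator)
  also have "\<dots> = (\<integral>\<^sup>+y. (ennreal (h y) * indicator {0..} y) * ennreal (exp (- (real k * y)) / real k) \<partial>lborel)"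
    using k by (subst nn_integral_cmult) (auto simp: nn_integral_exp_atLeast)
  also have "\<dots> = (\<integral>\<^sup>+y. ennreal (1 / real k) * (ennreal (exp (- (real k * y)) * h y) * indicator {0..} y) \<partial>lborel)"
    by (intro nn_integral_cong)
       (auto simp: nonneg ennreal_mult[symmetric] mult_ac split: split_indicator)
  also have "\<dots> = ennreal (1 / real k) * laplace h k"
    unfolding laplace_def by (rule nn_integral_cmult) measurable
  finally show ?thesis .
qed

text \<open>Expand 1 / (r exp x - 1) as the sum of r^(-i) exp (- i x) over i \<ge> 1 and integrate
  termwise, with j = k + i.\<close>

lemma laplace_geometric:
  assumes [measurable]: "g \<in> borel_measurable borel" "h \<in> borel_measurable borel"
    and g: "\<And>x. 0 \<le> x \<Longrightarrow> 0 \<le> g x"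
    and h: "\<And>x. 0 < x \<Longrightarrow> h x = g x / (r * exp x - 1)" and r: "r \<ge> 1"
  shows "laplace h k = (\<Sum>j. if k < j then ennreal (r ^ k / r ^ j) * laplace g j else 0)"
proof -
  have *: "ennreal (exp (- (real k * x)) * h x)
      = (\<Sum>j. if k < j then ennreal (r ^ k / r ^ j) * ennreal (exp (- (real j * x)) * g x) else 0)"
    if x: "x > 0" for x
  proof -
    have gx: "0 \<le> g x" using g[of x] x by simp
    define q where "q = exp (- x) / r"
    have "1 < r * exp x" using r x by (metis less_1_mult mult.left_neutral one_less_exp_iff order_le_less)
    then have q: "0 < q" "q < 1" "r * exp x - 1 = (1 - q) / q"
      using r by (auto simp: q_def field_simps exp_minus)
    define f where "f j = (if k < j then r ^ k / r ^ j * (exp (- (real j * x)) * g x) else 0)" for j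
    have e: "exp (- (real j * x)) = exp (- x) ^ j" for j
      by (simp add: exp_of_nat_mult[symmetric])
    \<comment> \<open>The terms up to index k are 0, so a shift by \<open>Suc k\<close> exposes a
      full geometric series of ratio q.\<close>
    have "f (j + Suc k) = exp (- (real k * x)) * g x * q * q ^ j" for j
      using r unfolding f_def q_def e by (simp add: power_add power_divide)
    moreover have "(\<lambda>j. exp (- (real k * x)) * g x * q * q ^ j) sums (exp (- (real k * x)) * g x * q * (1 / (1 - q)))"
      using q by (intro sums_mult geometric_sums) auto
    ultimately have "f sums (exp (- (real k * x)) * g x * q * (1 / (1 - q)))"
      using sums_iff_shift[of f "Suc k"] by (simp add: f_def)
    also have "exp (- (real k * x)) * g x * q * (1 / (1 - q)) = exp (- (real k * x)) * h x"
      using x q by (simp add: h)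
    finally have "f sums (exp (- (real k * x)) * h x)" .
    moreover have "0 \<le> f j" for j
      using r gx by (simp add: f_def)
    ultimately have "(\<Sum>j. ennreal (f j)) = ennreal (exp (- (real k * x)) * h x)"
      by (intro suminf_ennreal_eq)
    moreover have "ennreal (f j) = (if k < j then ennreal (r ^ k / r ^ j) * ennreal (exp (- (real j * x)) * g x) else 0)" for j
      using r gx by (simp add: f_def flip: ennreal_mult)
    ultimately show ?thesis by (simp only:)
  qed
  have "laplace h k = (\<integral>\<^sup>+x. (\<Sum>j. if k < j then ennreal (r ^ k / r ^ j) *
      (ennreal (exp (- (real j * x)) * g x) * indicator {0..} x) else 0) \<partial>lborel)"
    unfolding laplace_def
  proof (rule nn_integral_cong_AE)
    \<comment> \<open>For r = 1 the kernel is singular at the origin, which is a null set.\<close>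
    have "AE x in lborel. x \<noteq> (0::real)" by (rule AE_lborel_singleton)
    then show "AE x in lborel. ennreal (exp (- (real k * x)) * h x) * indicator {0..} x =
        (\<Sum>j. if k < j then ennreal (r ^ k / r ^ j) *
      (ennreal (exp (- (real j * x)) * g x) * indicator {0..} x) else 0)"
    proof eventually_elim
      case (elim x)
      then show ?case
        by (cases "x > 0") (simp_all add: * indicator_def cong: if_cong)
    qed
  qed
  also have "\<dots> = (\<Sum>j. \<integral>\<^sup>+x. (if k < j then ennreal (r ^ k / r ^ j) *
      (ennreal (exp (- (real j * x)) * g x) * indicator {0..} x) else 0) \<partial>lborel)"
    by (rule nn_integral_suminf) measurable
  also have "\<dots> = (\<Sum>j. if k < j then ennreal (r ^ k / r ^ j) * laplace g j else 0)"
    unfolding laplace_def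
    by (intro suminf_cong) (auto simp: nn_integral_cmult)
  finally show ?thesis .
qed

section \<open>Laplace transforms attached to argument lists\<close>

text \<open>
  With \<open>\<sigma> = \<plusminus>1\<close>, the function \<open>x \<mapsto> powser (amzv_coeff s) (\<sigma> (1 - exp (- x)))\<close> has constant
  sign \<open>e\<close> on \<open>[0, \<infinity>)\<close>; \<open>g\<close> records the Laplace transform of its absolute value at the positive
  integers. Being nonnegative, these transforms can be handled in \<^typ>\<open>ennreal\<close> without any
  convergence conditions.
\<close>

definition laplace_rep :: "int list \<Rightarrow> real \<Rightarrow> real \<Rightarrow> (nat \<Rightarrow> ennreal) \<Rightarrow> bool" where
  "laplace_rep s \<sigma> e g \<longleftrightarrow> 0 \<notin> set s \<and>
     (\<forall>x\<ge>0. 0 \<le> e * powser (amzv_coeff s) (\<sigma> * (1 - exp (- x)))) \<and>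
     (\<forall>k\<ge>1. laplace (\<lambda>x. e * powser (amzv_coeff s) (\<sigma> * (1 - exp (- x)))) k = g k)"

lemma powser_0: "powser c 0 = c 0"
  unfolding powser_def using powser_sums_zero[of c] by (simp add: sums_iff)

lemma abs_one_minus_exp_less:
  fixes x \<sigma> :: real
  assumes "0 \<le> x" "\<bar>\<sigma>\<bar> = 1"
  shows "\<bar>\<sigma> * (1 - exp (- x))\<bar> < 1"
  using assms by (simp add: abs_mult)

lemma nonneg_of_derivative:
  fixes H h :: "real \<Rightarrow> real"
  assumes "\<And>x. 0 \<le> x \<Longrightarrow> (H has_field_derivative h x) (at x)"
    and "\<And>x. 0 \<le> x \<Longrightarrow> 0 \<le> h x" and "H 0 = 0" and "0 \<le> x"
  shows "0 \<le> H x"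
  using DERIV_nonneg_imp_nondecreasing[of 0 x H] assms by auto

lemma amzv_coeff_Cons_unit:
  assumes "\<epsilon> = 1 \<or> \<epsilon> = - 1"
  shows "amzv_coeff (\<epsilon> # s) = (\<lambda>n. of_int \<epsilon> ^ n / real n * (\<Sum>k<n. amzv_coeff s k))"
  using assms by (auto simp: fun_eq_iff)

text \<open>Chain rule for t = \<sigma> (1 - exp (- x)). The argument sign \<sigma> of the longer
  list becomes \<tau> for the shorter one, and the prefactor \<tau> cancels \<sigma> and \<epsilon>
  because \<tau> \<sigma> \<epsilon> = 1.\<close>

lemma powser_Cons_has_derivative:
  fixes \<sigma> e :: real
  assumes s: "0 \<notin> set s" and \<epsilon>: "\<epsilon> = 1 \<or> \<epsilon> = - 1" and \<sigma>: "\<bar>\<sigma>\<bar> = 1" and x: "0 \<le> x"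
    and \<tau>: "\<tau> = \<sigma> * of_int \<epsilon>"
  shows "((\<lambda>x. \<tau> * e * powser (amzv_coeff (\<epsilon> # s)) (\<sigma> * (1 - exp (- x)))) has_field_derivative
     e * powser (amzv_coeff s) (\<tau> * (1 - exp (- x))) * (exp (- x) / (1 - \<tau> * (1 - exp (- x))))) (at x)"
proof -
  let ?t = "\<sigma> * (1 - exp (- x))"
  have "(powser (amzv_coeff (\<epsilon> # s)) has_field_derivative
      of_int \<epsilon> / (1 - of_int \<epsilon> * ?t) * powser (amzv_coeff s) (of_int \<epsilon> * ?t)) (at ?t)"
    unfolding amzv_coeff_Cons_unit[OF \<epsilon>]
    using \<epsilon> abs_one_minus_exp_less[OF x \<sigma>]
    by (intro powser_has_derivative_step abs_amzv_coeff_le_1 s) auto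
  moreover have "((\<lambda>x. \<sigma> * (1 - exp (- x))) has_field_derivative \<sigma> * exp (- x)) (at x)"
    by (auto intro!: derivative_eq_intros)
  ultimately have "((\<lambda>x. powser (amzv_coeff (\<epsilon> # s)) (\<sigma> * (1 - exp (- x)))) has_field_derivative
      of_int \<epsilon> / (1 - of_int \<epsilon> * ?t) * powser (amzv_coeff s) (of_int \<epsilon> * ?t) * (\<sigma> * exp (- x))) (at x)"
    by (rule DERIV_chain2)
  then have D: "((\<lambda>x. \<tau> * e * powser (amzv_coeff (\<epsilon> # s)) (\<sigma> * (1 - exp (- x)))) has_field_derivative
      \<tau> * e * (of_int \<epsilon> / (1 - of_int \<epsilon> * ?t) * powser (amzv_coeff s) (of_int \<epsilon> * ?t) * (\<sigma> * exp (- x)))) (at x)"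
    by (rule DERIV_cmult)
  have t: "of_int \<epsilon> * ?t = \<tau> * (1 - exp (- x))"
    by (simp add: \<tau>)
  have 1: "\<tau> * (\<sigma> * of_int \<epsilon>) = 1"
    using \<epsilon> \<sigma> by (auto simp: \<tau> abs_if split: if_splits)
  have "\<tau> * e * (of_int \<epsilon> / (1 - y) * p * (\<sigma> * exp (- x)))
      = \<tau> * (\<sigma> * of_int \<epsilon>) * (e * p * (exp (- x) / (1 - y)))" for y p
    by (simp add: mult_ac)
  from D[unfolded t this 1] show ?thesis
    by (simp only: mult_1)
qed

lemma laplace_rep_Nil: "laplace_rep [] \<sigma> 1 (\<lambda>k. ennreal (1 / real k))"
proof -
  have "powser (amzv_coeff []) t = 1" for t
  proof -
    have "(\<lambda>n. amzv_coeff [] n * t ^ n) = (\<lambda>n. if n = 0 then 1 else 0)" by auto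
    then show ?thesis
      unfolding powser_def using sums_single[of 0 "\<lambda>_. 1 :: real"] by (simp only: sums_iff)
  qed
  moreover have "laplace (\<lambda>_. 1) k = ennreal (1 / real k)" if "k \<ge> 1" for k
    using nn_integral_exp_atLeast[of "real k" 0] that by (simp add: laplace_def)
  ultimately show ?thesis
    by (simp add: laplace_rep_def)
qed

text \<open>Case \<tau> = 1: the kernel exp (- x) / (1 - (1 - exp (- x))) is 1, so integration only
  contributes the factor 1 / k.\<close>

lemma laplace_rep_Cons_trivial_sign:
  assumes rep: "laplace_rep s 1 e g" and \<epsilon>: "\<epsilon> = 1 \<or> \<epsilon> = - 1"
  shows "laplace_rep (\<epsilon> # s) (of_int \<epsilon>) e (\<lambda>k. ennreal (1 / real k) * g k)"
proof -
  have [simp]: "of_int \<epsilon> * of_int \<epsilon> = (1::real)" "\<bar>of_int \<epsilon> :: real\<bar> = 1" using \<epsilon> by auto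
  let ?h = "\<lambda>x. e * powser (amzv_coeff s) (1 * (1 - exp (- x)))"
  let ?H = "\<lambda>x. e * powser (amzv_coeff (\<epsilon> # s)) (of_int \<epsilon> * (1 - exp (- x)))"
  have d: "(?H has_field_derivative ?h x) (at x)" if "0 \<le> x" for x
    using powser_Cons_has_derivative[of s \<epsilon> "of_int \<epsilon>" x 1 e] rep \<epsilon> that
    by (simp add: laplace_rep_def)
  have h: "0 \<le> ?h x" if "0 \<le> x" for x
    using rep that by (simp add: laplace_rep_def)
  have H0: "?H 0 = 0" by (simp add: powser_0)
  have "laplace ?H k = ennreal (1 / real k) * laplace ?h k" if "k \<ge> 1" for k
    by (intro laplace_derivative[OF _ d h H0 that]) measurable
  then show ?thesis
    using rep nonneg_of_derivative[OF d h H0] \<epsilon> by (auto simp: laplace_rep_def simp del: amzv_coeff.simps)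
qed

text \<open>The forms dt/(1 + t) and dt/t in the variable x. The factor 1 in the second one fits the
  pattern of \<open>laplace_geometric\<close> with r = 1.\<close>

lemma exp_quotient:
  fixes x :: real
  shows "exp (- x) / (1 - (- 1) * (1 - exp (- x))) = 1 / (2 * exp x - 1)"
    and "0 < x \<Longrightarrow> exp (- x) / (1 - exp (- x)) = 1 / (1 * exp x - 1)"
  by (simp_all add: exp_minus field_simps)

text \<open>Case \<tau> = -1. The derivative h is kept apart from its primitive H because its
  transform is also needed at k = 0, where dividing by k is impossible.\<close>

lemma laplace_rep_Cons_sign_change_derivative:
  fixes s :: "int list" and \<epsilon> :: int
  assumes rep: "laplace_rep s (- 1) e g" and \<epsilon>: "\<epsilon> = 1 \<or> \<epsilon> = - 1"
  defines "H \<equiv> \<lambda>x. - e * powser (amzv_coeff (\<epsilon> # s)) (of_int (- \<epsilon>) * (1 - exp (- x)))"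
    and "h \<equiv> \<lambda>x. e * powser (amzv_coeff s) ((- 1) * (1 - exp (- x))) / (2 * exp x - 1)"
  shows "h \<in> borel_measurable borel"
    and "0 \<le> x \<Longrightarrow> (H has_field_derivative h x) (at x)"
    and "0 \<le> x \<Longrightarrow> 0 \<le> h x" and "H 0 = 0"
    and "laplace h k = (\<Sum>j. if k < j then ennreal (2 ^ k / 2 ^ j) * g j else 0)"
proof -
  have [simp]: "of_int \<epsilon> * of_int \<epsilon> = (1::real)" "\<bar>of_int \<epsilon> :: real\<bar> = 1" using \<epsilon> by auto
  show [measurable]: "h \<in> borel_measurable borel" unfolding h_def by measurable
  show "(H has_field_derivative h x) (at x)" if "0 \<le> x"
    using powser_Cons_has_derivative[of s \<epsilon> "of_int (- \<epsilon>)" x "- 1" e] rep \<epsilon> that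
    unfolding exp_quotient(1) by (simp add: laplace_rep_def H_def h_def)
  have nn: "0 \<le> e * powser (amzv_coeff s) ((- 1) * (1 - exp (- x)))" if "0 \<le> x" for x
    using rep that unfolding laplace_rep_def by blast
  show "0 \<le> h x" if "0 \<le> x"
  proof -
    have "1 \<le> exp x" using that by simp
    then have "0 \<le> 2 * exp x - 1" by linarith
    then show ?thesis
      unfolding h_def using nn[OF that] by (rule divide_nonneg_nonneg[rotated])
  qed
  show "H 0 = 0" by (simp add: H_def powser_0)
  have "laplace h k = (\<Sum>j. if k < j then ennreal (2 ^ k / 2 ^ j) *
      laplace (\<lambda>x. e * powser (amzv_coeff s) ((- 1) * (1 - exp (- x)))) j else 0)"
    by (rule laplace_geometric) (use nn in \<open>auto simp: h_def\<close>)
  also have "\<dots> = (\<Sum>j. if k < j then ennreal (2 ^ k / 2 ^ j) * g j else 0)"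
    using rep unfolding laplace_rep_def by (intro suminf_cong) auto
  finally show "laplace h k = (\<Sum>j. if k < j then ennreal (2 ^ k / 2 ^ j) * g j else 0)" .
qed

lemma laplace_rep_Cons_sign_change:
  assumes rep: "laplace_rep s (- 1) e g"
  shows "laplace_rep (- 1 # s) 1 (- e)
    (\<lambda>k. ennreal (1 / real k) * (\<Sum>j. if k < j then ennreal (2 ^ k / 2 ^ j) * g j else 0))"
proof -
  note C = laplace_rep_Cons_sign_change_derivative[OF rep, of "- 1", OF disjI2[OF refl]]
  show ?thesis
    using laplace_derivative[OF C(1,2,3,4)] nonneg_of_derivative[OF C(2,3,4)] rep
    unfolding C(5) by (auto simp: laplace_rep_def simp del: amzv_coeff.simps)
qed

text \<open>An entry 2 is an entry 1 followed by one more division by n, that is, by integration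
  against dt/t; this gives a geometric sum with r = 1.\<close>

lemma laplace_rep_Cons_2:
  assumes rep: "laplace_rep s 1 e g"
  shows "laplace_rep (2 # s) 1 e
    (\<lambda>k. ennreal (1 / real k) * (\<Sum>j. if k < j then ennreal (1 / real j) * g j else 0))"
proof -
  have rep1: "laplace_rep (1 # s) 1 e (\<lambda>k. ennreal (1 / real k) * g k)"
    using laplace_rep_Cons_trivial_sign[OF rep, of 1] by simp
  define c where "c = amzv_coeff (1 # s)"
  have c: "\<bar>c n\<bar> \<le> 1" "c 0 = 0" for n
    using rep1 abs_amzv_coeff_le_1[of "1 # s" n] by (simp_all add: c_def laplace_rep_def)
  have c2: "amzv_coeff (2 # s) = (\<lambda>n. c n / real n)"
    by (auto simp: fun_eq_iff c_def power2_eq_square)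
  define G where "G x = e * powser c (1 - exp (- x))" for x
  define H where "H x = e * powser (amzv_coeff (2 # s)) (1 - exp (- x))" for x
  define h where "h x = e * (powser (\<lambda>n. c (Suc n)) (1 - exp (- x)) * exp (- x))" for x
  have [measurable]: "h \<in> borel_measurable borel" "G \<in> borel_measurable borel"
    unfolding h_def G_def by measurable
  have G: "0 \<le> G x" if "0 \<le> x" for x
    using rep1 that by (simp add: laplace_rep_def G_def c_def del: amzv_coeff.simps)
  have d: "(H has_field_derivative h x) (at x)" if "0 \<le> x" for x
  proof -
    have "(powser (\<lambda>n. c n / real n) has_field_derivative powser (\<lambda>n. c (Suc n)) (1 - exp (- x)))
        (at (1 - exp (- x)))"
      using that by (intro powser_has_derivative_div c) auto
    moreover have "((\<lambda>x. 1 - exp (- x)) has_field_derivative exp (- x)) (at x)"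
      by (auto intro!: derivative_eq_intros)
    ultimately show ?thesis
      unfolding H_def[abs_def] h_def c2 by (intro DERIV_cmult) (rule DERIV_chain2)
  qed
  have hG: "h x = G x / (1 * exp x - 1)" if "0 < x" for x
  proof -
    have "(1 - exp (- x)) * powser (\<lambda>n. c (Suc n)) (1 - exp (- x)) = powser c (1 - exp (- x))"
      using that by (intro powser_has_derivative_div c) auto
    then have "h x = G x * (exp (- x) / (1 - exp (- x)))"
      unfolding h_def G_def using that by (auto simp flip: \<open>_ = powser c _\<close>)
    also have "\<dots> = G x / (1 * exp x - 1)"
      using exp_quotient(2)[OF that] by simp
    finally show ?thesis .
  qed
  have h: "0 \<le> h x" if "0 \<le> x" for x
  proof (cases "x = 0")
    case False
    then have "1 < exp x" using that by simp
    then show ?thesis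
      using hG[of x] G[of x] that False by simp
  next
    case True
    have "isCont (powser (\<lambda>n. c (Suc n))) 0"
      unfolding powser_def[abs_def]
      using summable_powser_bounded(2)[of "\<lambda>n. c (Suc n)" 1 "1/2"] c
      by (intro isCont_powser[where K = "1/2"]) auto
    then have "isCont (\<lambda>x. powser (\<lambda>n. c (Suc n)) (1 - exp (- x))) 0"
      by (intro isCont_o2[where g = "powser (\<lambda>n. c (Suc n))" and f = "\<lambda>x. 1 - exp (- x)"]) simp_all
    then have "isCont (\<lambda>x. e * (powser (\<lambda>n. c (Suc n)) (1 - exp (- x)) * exp (- x))) 0"
      by simp
    then have "(h \<longlongrightarrow> h 0) (at_right 0)"
      unfolding h_def[abs_def] continuous_within by (rule filterlim_at_split[THEN iffD1, THEN conjunct2])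
    moreover have "0 \<le> h y" if "0 < y" for y
    proof -
      have "1 < exp y" using that by simp
      then show ?thesis using hG[of y] G[of y] that by simp
    qed
    then have "\<forall>\<^sub>F y in at_right 0. 0 \<le> h y"
      by (auto simp: eventually_at_filter)
    ultimately have "0 \<le> h 0"
      by (rule tendsto_lowerbound) simp
    with True show ?thesis by simp
  qed
  have H0: "H 0 = 0" by (simp add: H_def powser_0)
  have "laplace h k = (\<Sum>j. if k < j then ennreal (1 / real j) * g j else 0)" for k
  proof -
    have "laplace h k = (\<Sum>j. if k < j then ennreal (1 ^ k / 1 ^ j) * laplace G j else 0)"
      by (rule laplace_geometric[OF _ _ G hG]) auto
    also have "\<dots> = (\<Sum>j. if k < j then ennreal (1 / real j) * g j else 0)"
      using rep1 by (intro suminf_cong) (auto simp: laplace_rep_def G_def[abs_def] c_def simp del: amzv_coeff.simps)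
    finally show ?thesis .
  qed
  moreover have "laplace H k = ennreal (1 / real k) * laplace h k" if "k \<ge> 1" for k
    by (rule laplace_derivative[OF _ d h H0 that]) measurable
  ultimately show ?thesis
    using nonneg_of_derivative[OF d h H0] rep
    by (auto simp: laplace_rep_def H_def[abs_def] simp del: amzv_coeff.simps)
qed

text \<open>By Abel's theorem the value is, up to sign, the limit at infinity of a primitive
  vanishing at 0. It is therefore the total integral of the derivative, which is the transform at k
  = 0. Nonnegativity is recorded because \<open>ennreal\<close> alone would lose the sign.\<close>

lemma amzv_minus_one_Cons:
  assumes rep: "laplace_rep s (- 1) e g"
  shows "ennreal (- e * amzv (- 1 # s)) = (\<Sum>j. if 0 < j then ennreal (1 / 2 ^ j) * g j else 0)"
    and "0 \<le> - e * amzv (- 1 # s)"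
proof -
  note C = laplace_rep_Cons_sign_change_derivative[OF rep, of "- 1", OF disjI2[OF refl]]
  have "summable (amzv_coeff (- 1 # s))"
    using rep by (intro summable_amzv_coeff_minus_one) (simp add: laplace_rep_def)
  then have "(powser (amzv_coeff (- 1 # s)) \<longlongrightarrow> amzv (- 1 # s)) (at_left 1)"
    unfolding amzv_eq_suminf by (rule Abel_limit_theorem)
  moreover have "filterlim (\<lambda>x::real. 1 - exp (- x)) (at_left 1) at_top"
    unfolding filterlim_at
  proof
    show "\<forall>\<^sub>F x::real in at_top. 1 - exp (- x) \<in> {..<1} \<and> 1 - exp (- x) \<noteq> 1"
      by simp
    have "((\<lambda>x::real. 1 - exp (- x)) \<longlongrightarrow> 1 - 0) at_top"
      by (intro tendsto_intros filterlim_compose[OF exp_at_bot] filterlim_uminus_at_bot_at_top)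
    then show "((\<lambda>x::real. 1 - exp (- x)) \<longlongrightarrow> 1) at_top" by simp
  qed
  ultimately have lim: "((\<lambda>x. powser (amzv_coeff (- 1 # s)) (1 - exp (- x))) \<longlongrightarrow> amzv (- 1 # s)) at_top"
    by (rule filterlim_compose)
  then have T: "((\<lambda>x. - e * powser (amzv_coeff (- 1 # s)) (of_int (- (- 1)) * (1 - exp (- x))))
      \<longlongrightarrow> - e * amzv (- 1 # s)) at_top"
    by (intro tendsto_mult tendsto_const) simp
  let ?h = "\<lambda>x. e * powser (amzv_coeff s) ((- 1) * (1 - exp (- x))) / (2 * exp x - 1)"
  have "laplace ?h 0 = (\<integral>\<^sup>+x. ennreal (?h x) * indicator {0..} x \<partial>lborel)"
    by (simp add: laplace_def)
  also have "\<dots> = ennreal (- e * amzv (- 1 # s) -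
      - e * powser (amzv_coeff (- 1 # s)) (of_int (- (- 1)) * (1 - exp (- 0))))"
    by (rule nn_integral_FTC_atLeast[OF C(1,2,3) T])
  also have "\<dots> = ennreal (- e * amzv (- 1 # s))"
    unfolding C(4) by simp
  finally show "ennreal (- e * amzv (- 1 # s)) = (\<Sum>j. if 0 < j then ennreal (1 / 2 ^ j) * g j else 0)"
    using C(5)[of 0] by (simp cong: if_cong)
  have "\<forall>\<^sub>F x in at_top. 0 \<le> - e * powser (amzv_coeff (- 1 # s)) (of_int (- (- 1)) * (1 - exp (- x)))"
    using eventually_ge_at_top[of 0] by eventually_elim (rule nonneg_of_derivative[OF C(2,3,4)])
  with T show "0 \<le> - e * amzv (- 1 # s)"
    by (rule tendsto_lowerbound) simp
qed

subsection \<open>Multiple sums\<close>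

definition tail_sum :: "(nat \<Rightarrow> ennreal) \<Rightarrow> nat \<Rightarrow> ennreal" where
  "tail_sum f k = (\<Sum>j. if k < j then f j else 0)"

text \<open>At k = 0 the value is 0 whenever p \<ge> 1, so sums over all naturals effectively start
  at 1.\<close>

definition inv_pow :: "nat \<Rightarrow> nat \<Rightarrow> ennreal" where
  "inv_pow p k = ennreal ((1 / real k) ^ p)"

lemma inv_pow_mult: "inv_pow p k * inv_pow q k = inv_pow (p + q) k"
  by (simp add: inv_pow_def power_add flip: ennreal_mult)

lemma inv_pow_mult_left: "inv_pow p k * (inv_pow q k * z) = inv_pow (p + q) k * z"
  by (simp add: inv_pow_mult flip: mult.assoc)

lemma inv_pow_1: "ennreal (1 / real k) = inv_pow 1 k"
  by (simp add: inv_pow_def)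

lemma laplace_rep_ones_append:
  assumes "laplace_rep s 1 e g"
  shows "laplace_rep (ones d @ s) 1 e (\<lambda>k. inv_pow d k * g k)"
proof (induction d)
  case 0
  show ?case using assms by (simp add: inv_pow_def)
next
  case (Suc d)
  show ?case
    using laplace_rep_Cons_trivial_sign[OF Suc, of 1] by (simp add: inv_pow_1 inv_pow_mult_left)
qed

lemma laplace_rep_ones: "laplace_rep (ones d) 1 1 (inv_pow (Suc d))"
  using laplace_rep_ones_append[OF laplace_rep_Nil, of d]
  by (simp add: inv_pow_1 inv_pow_mult)

lemma laplace_rep_ones_2:
  assumes "laplace_rep s 1 e g"
  shows "laplace_rep (ones d @ 2 # s) 1 e
    (\<lambda>k. inv_pow (Suc d) k * tail_sum (\<lambda>j. inv_pow 1 j * g j) k)"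
  using laplace_rep_ones_append[OF laplace_rep_Cons_2[OF assms], of d]
  by (simp add: inv_pow_1 inv_pow_mult_left tail_sum_def cong: if_cong)

lemma half_pow_cancel: "ennreal (1 / 2 ^ k) * (ennreal (2 ^ k) * z) = z"
  by (simp flip: ennreal_mult mult.assoc)

text \<open>The inner -1 changes the argument sign to -1 and the outer one restores it, while e is
  negated once. The weight 2^(k - j) is split into two factors so that nested pairs telescope
  through \<open>half_pow_cancel\<close>.\<close>

lemma laplace_rep_ones_minus_one_minus_one:
  assumes "laplace_rep s 1 e g"
  shows "laplace_rep (ones d @ - 1 # - 1 # s) 1 (- e)
    (\<lambda>k. ennreal (2 ^ k) * (inv_pow (Suc d) k * tail_sum (\<lambda>j. ennreal (1 / 2 ^ j) * (inv_pow 1 j * g j)) k))"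
proof -
  have tail: "(\<Sum>j. if k < j then ennreal (2 ^ k / 2 ^ j) * f j else 0) = ennreal (2 ^ k) * tail_sum (\<lambda>j. ennreal (1 / 2 ^ j) * f j) k"
    for f k
  proof -
    have "ennreal (2 ^ k / 2 ^ j) = ennreal (2 ^ k) * ennreal (1 / 2 ^ j)" for j
      by (simp flip: ennreal_mult)
    then show ?thesis
      unfolding tail_sum_def
      by (simp add: mult.assoc if_distrib[of "\<lambda>z. ennreal (2 ^ k) * z"] cong: if_cong flip: ennreal_suminf_cmult)
  qed
  have "laplace_rep (- 1 # s) (- 1) e (\<lambda>k. inv_pow 1 k * g k)"
    using laplace_rep_Cons_trivial_sign[OF assms, of "- 1"] by (simp add: inv_pow_1)
  from laplace_rep_ones_append[OF laplace_rep_Cons_sign_change[OF this], of d] show ?thesis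
    unfolding inv_pow_1 inv_pow_mult_left tail
    by (simp add: mult.left_commute[of "inv_pow (Suc d) _"])
qed

lemma amzv_minus_one_minus_one:
  assumes "laplace_rep s 1 e g"
  shows "ennreal (- e * amzv (- 1 # - 1 # s)) = (\<Sum>j. ennreal (1 / 2 ^ j) * (inv_pow 1 j * g j))"
    and "0 \<le> - e * amzv (- 1 # - 1 # s)"
proof -
  have rep: "laplace_rep (- 1 # s) (- 1) e (\<lambda>k. inv_pow 1 k * g k)"
    using laplace_rep_Cons_trivial_sign[OF assms, of "- 1"] by (simp add: inv_pow_1)
  \<comment> \<open>The term j = 0 vanishes because \<open>inv_pow 1 0\<close> is 0.\<close>
  have "(if 0 < j then ennreal (1 / 2 ^ j) * (inv_pow 1 j * g j) else 0)
      = ennreal (1 / 2 ^ j) * (inv_pow 1 j * g j)" for j :: nat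
    by (simp add: inv_pow_def)
  then show "ennreal (- e * amzv (- 1 # - 1 # s)) = (\<Sum>j. ennreal (1 / 2 ^ j) * (inv_pow 1 j * g j))"
    using amzv_minus_one_Cons(1)[OF rep] by (simp only:)
  show "0 \<le> - e * amzv (- 1 # - 1 # s)"
    by (rule amzv_minus_one_Cons(2)[OF rep])
qed

section \<open>Rearrangement of multiple sums of nonnegative terms\<close>

lemma suminf_swap_ennreal:
  fixes f :: "nat \<Rightarrow> nat \<Rightarrow> ennreal"
  shows "(\<Sum>i. \<Sum>j. f i j) = (\<Sum>j. \<Sum>i. f i j)"
  using nn_integral_suminf[of "\<lambda>j i. f i j" "count_space UNIV"]
  by (simp add: nn_integral_count_space_nat)

lemma suminf_eq_sum_plus_tail: "suminf f = (\<Sum>j\<le>k. f j) + tail_sum f k"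
proof -
  have "suminf f = (\<Sum>j. (if j \<in> {..k} then f j else 0) + (if k < j then f j else 0))"
    by (intro suminf_cong) auto
  also have "\<dots> = (\<Sum>j. if j \<in> {..k} then f j else 0) + tail_sum f k"
    unfolding tail_sum_def by (intro suminf_add[symmetric]) auto
  also have "(\<Sum>j. if j \<in> {..k} then f j else 0) = (\<Sum>j\<le>k. f j)"
    using sums_If_finite_set[of "{..k}" f] by (simp add: sums_iff)
  finally show ?thesis .
qed

text \<open>Tonelli over the pairs k \<le> n, with the diagonal split off so that the remaining tail
  is strict.\<close>

lemma suminf_sum_swap:
  fixes u v :: "nat \<Rightarrow> ennreal"
  shows "(\<Sum>n. u n * (\<Sum>k\<le>n. v k)) = (\<Sum>k. v k * (u k + tail_sum u k))"
proof -
  have "u n * (\<Sum>k\<le>n. v k) = (\<Sum>k. if k \<in> {..n} then v k * u n else 0)" for n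
    using sums_If_finite_set[of "{..n}" "\<lambda>k. v k * u n"]
    by (simp add: sums_iff sum_distrib_left mult.commute)
  then have "(\<Sum>n. u n * (\<Sum>k\<le>n. v k)) = (\<Sum>n. \<Sum>k. if k \<in> {..n} then v k * u n else 0)"
    by (simp only:)
  also have "\<dots> = (\<Sum>k. \<Sum>n. if k \<in> {..n} then v k * u n else 0)"
    by (rule suminf_swap_ennreal)
  also have "\<dots> = (\<Sum>k. v k * (u k + tail_sum u k))"
  proof (rule suminf_cong)
    fix k
    have "(\<Sum>n. if k \<in> {..n} then v k * u n else 0)
        = (\<Sum>n. (if n \<in> {k} then v k * u n else 0) + v k * (if k < n then u n else 0))"
      by (intro suminf_cong) auto
    also have "\<dots> = (\<Sum>n. if n \<in> {k} then v k * u n else 0) + v k * tail_sum u k"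
      unfolding tail_sum_def ennreal_suminf_cmult[symmetric] by (intro suminf_add[symmetric]) auto
    also have "(\<Sum>n. if n \<in> {k} then v k * u n else 0) = v k * u k"
      using sums_If_finite_set[of "{k}" "\<lambda>n. v k * u n"] by (simp add: sums_iff)
    finally show "(\<Sum>n. if k \<in> {..n} then v k * u n else 0) = v k * (u k + tail_sum u k)"
      by (simp add: distrib_left)
  qed
  finally show ?thesis .
qed

lemma tail_sum_add: "tail_sum (\<lambda>k. f k + g k) n = tail_sum f n + tail_sum g n"
proof -
  have "(if n < k then f k + g k else 0) = (if n < k then f k else 0) + (if n < k then g k else 0)" for k
    by simp
  then show ?thesis
    unfolding tail_sum_def by (simp only: suminf_add[OF summableI summableI])
qed

lemma tail_sum_mult_right: "tail_sum (\<lambda>k. f k * c) n = tail_sum f n * c"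
proof -
  have "(if n < k then f k * c else 0) = (if n < k then f k else 0) * c" for k
    by simp
  then show ?thesis
    unfolding tail_sum_def by (simp only: ennreal_suminf_multc)
qed

text \<open>For fixed n, the condition n < k < l is n < k minus (n < k and l \<le> k), and the
  latter is l \<le> k minus (k \<le> n and l \<le> k). The identity is arranged additively to avoid
  subtraction in \<open>ennreal\<close>.\<close>

lemma triple_sum_inclusion_exclusion:
  fixes a b d :: "nat \<Rightarrow> ennreal"
  shows "(\<Sum>n. a n * tail_sum (\<lambda>k. b k * tail_sum d k) n) + (\<Sum>n. a n) * (\<Sum>k. b k * (\<Sum>l\<le>k. d l))
    = (\<Sum>n. a n * (\<Sum>k\<le>n. b k * (\<Sum>l\<le>k. d l))) + (\<Sum>n. a n * tail_sum b n) * (\<Sum>l. d l)"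
proof -
  let ?B = "\<lambda>k. b k * (\<Sum>l\<le>k. d l)"
  have "a n * tail_sum (\<lambda>k. b k * tail_sum d k) n + a n * (\<Sum>k. ?B k)
      = a n * (\<Sum>k\<le>n. ?B k) + a n * tail_sum b n * (\<Sum>l. d l)" for n
  proof -
    have bd: "b k * (\<Sum>l. d l) = ?B k + b k * tail_sum d k" for k
      by (simp only: suminf_eq_sum_plus_tail[of d k] distrib_left)
    have "tail_sum b n * (\<Sum>l. d l) = tail_sum (\<lambda>k. b k * (\<Sum>l. d l)) n"
      by (simp add: tail_sum_mult_right)
    also have "\<dots> = tail_sum (\<lambda>k. ?B k + b k * tail_sum d k) n"
      by (simp only: bd)
    finally have "tail_sum b n * (\<Sum>l. d l) = tail_sum ?B n + tail_sum (\<lambda>k. b k * tail_sum d k) n"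
      by (simp add: tail_sum_add)
    then show ?thesis
      by (simp add: suminf_eq_sum_plus_tail[of ?B n] mult.assoc distrib_left add_ac)
  qed
  then have "(\<Sum>n. a n * tail_sum (\<lambda>k. b k * tail_sum d k) n + a n * (\<Sum>k. ?B k))
      = (\<Sum>n. a n * (\<Sum>k\<le>n. ?B k) + a n * tail_sum b n * (\<Sum>l. d l))"
    by (simp only:)
  then show ?thesis
    by (simp add: suminf_add[symmetric])
qed

text \<open>Summing over l \<le> k \<le> n from the smallest index outwards, the four terms are the
  cases l < k < n, l = k = n, l = k < n and l < k = n.\<close>

lemma triple_sum_reverse:
  fixes a b d :: "nat \<Rightarrow> ennreal"
  shows "(\<Sum>n. a n * (\<Sum>k\<le>n. b k * (\<Sum>l\<le>k. d l)))
    = (\<Sum>l. d l * tail_sum (\<lambda>k. b k * tail_sum a k) l) + (\<Sum>l. d l * b l * a l)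
      + (\<Sum>l. d l * b l * tail_sum a l) + (\<Sum>l. d l * tail_sum (\<lambda>k. b k * a k) l)"
proof -
  have "(\<Sum>n. a n * (\<Sum>k\<le>n. b k * (\<Sum>l\<le>k. d l))) = (\<Sum>k. b k * (a k + tail_sum a k) * (\<Sum>l\<le>k. d l))"
    by (simp add: suminf_sum_swap mult_ac)
  also have "\<dots> = (\<Sum>l. d l * (b l * (a l + tail_sum a l) + tail_sum (\<lambda>k. b k * (a k + tail_sum a k)) l))"
    by (rule suminf_sum_swap)
  also have "\<dots> = (\<Sum>l. d l * tail_sum (\<lambda>k. b k * tail_sum a k) l + d l * b l * a l
      + d l * b l * tail_sum a l + d l * tail_sum (\<lambda>k. b k * a k) l)"
    by (simp add: distrib_left tail_sum_add mult_ac add_ac)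
  finally show ?thesis
    by (simp add: suminf_add[symmetric])
qed

section \<open>Values with positive arguments\<close>

lemma amzv_ennreal:
  assumes "summable (amzv_coeff s)" and "\<And>n. 0 \<le> amzv_coeff s n"
  shows "ennreal (amzv s) = (\<Sum>n. ennreal (amzv_coeff s n))" and "0 \<le> amzv s"
  unfolding amzv_eq_suminf
  using suminf_ennreal2[OF assms(2,1)] suminf_nonneg[OF assms] by simp_all

lemma amzv_coeff_single:
  assumes "p \<ge> 1"
  shows "amzv_coeff [int p] n = (1 / real n) ^ p"
  using assms by (cases n) (auto simp: power_divide sum.delta)

lemma summable_inv_pow:
  assumes "p \<ge> 2"
  shows "summable (\<lambda>n. (1 / real n) ^ p)"
  using inverse_power_summable[OF assms, where 'a = real]
  by (simp add: power_divide inverse_eq_divide)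

lemma amzv_single:
  assumes "p \<ge> 2"
  shows "ennreal (amzv [int p]) = (\<Sum>n. inv_pow p n)" and "0 \<le> amzv [int p]"
proof -
  have eq: "amzv_coeff [int p] = (\<lambda>n. (1 / real n) ^ p)"
    using assms by (intro ext amzv_coeff_single) auto
  have "summable (amzv_coeff [int p])" "0 \<le> amzv_coeff [int p] n" for n
    unfolding eq using summable_inv_pow[OF assms] by simp_all
  note * = amzv_ennreal[OF this]
  show "ennreal (amzv [int p]) = (\<Sum>n. inv_pow p n)"
    using *(1) unfolding eq inv_pow_def .
  show "0 \<le> amzv [int p]"
    by (rule *(2))
qed

lemma amzv_double:
  assumes "p \<ge> 2" "q \<ge> 2"
  shows "ennreal (amzv [int p, int q]) = (\<Sum>n. inv_pow p n * (\<Sum>k<n. inv_pow q k))"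
    and "0 \<le> amzv [int p, int q]"
proof -
  have eq: "amzv_coeff [int p, int q] = (\<lambda>n. (1 / real n) ^ p * (\<Sum>k<n. (1 / real k) ^ q))"
  proof
    fix n
    have "amzv_coeff [int p, int q] n
        = of_int (sgn (int p)) ^ n / real n ^ nat \<bar>int p\<bar> * (\<Sum>k<n. amzv_coeff [int q] k)"
      by (rule amzv_coeff.simps(2))
    also have "(\<Sum>k<n. amzv_coeff [int q] k) = (\<Sum>k<n. (1 / real k) ^ q)"
      using assms by (intro sum.cong amzv_coeff_single) auto
    finally show "amzv_coeff [int p, int q] n = (1 / real n) ^ p * (\<Sum>k<n. (1 / real k) ^ q)"
      using assms by (simp add: power_divide)
  qed
  have "summable (amzv_coeff [int p, int q])"
  proof (rule summable_comparison_test')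
    show "summable (\<lambda>n. (1 / real n) ^ p * (\<Sum>k. (1 / real k) ^ q))"
      by (intro summable_mult2 summable_inv_pow assms)
    show "norm (amzv_coeff [int p, int q] n) \<le> (1 / real n) ^ p * (\<Sum>k. (1 / real k) ^ q)" if "n \<ge> 0" for n
      unfolding eq using assms(2)
      by (auto simp: abs_mult sum_nonneg intro!: mult_left_mono sum_le_suminf summable_inv_pow)
  qed
  moreover have nn: "0 \<le> amzv_coeff [int p, int q] n" for n
    unfolding eq by (auto intro!: mult_nonneg_nonneg sum_nonneg)
  moreover have "ennreal (amzv_coeff [int p, int q] n) = inv_pow p n * (\<Sum>k<n. inv_pow q k)" for n
    unfolding eq inv_pow_def by (simp add: ennreal_mult sum_nonneg)
  ultimately show "ennreal (amzv [int p, int q]) = (\<Sum>n. inv_pow p n * (\<Sum>k<n. inv_pow q k))"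
    and "0 \<le> amzv [int p, int q]"
    using amzv_ennreal[of "[int p, int q]"] by auto
qed

text \<open>The diagonal k = n of the non-strict double sum is the single zeta value.\<close>

lemma amzv_star:
  assumes "p \<ge> 2" "q \<ge> 2"
  shows "ennreal (amzv [int p + int q] + amzv [int p, int q]) = (\<Sum>n. inv_pow p n * (\<Sum>k\<le>n. inv_pow q k))"
proof -
  have "inv_pow p n * (\<Sum>k\<le>n. inv_pow q k) = inv_pow (p + q) n + inv_pow p n * (\<Sum>k<n. inv_pow q k)" for n
    by (simp add: lessThan_Suc_atMost[symmetric] distrib_left inv_pow_mult add.commute)
  moreover have "ennreal (amzv [int p + int q] + amzv [int p, int q])
      = (\<Sum>n. inv_pow (p + q) n) + (\<Sum>n. inv_pow p n * (\<Sum>k<n. inv_pow q k))"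
    using amzv_single[of "p + q"] amzv_double[OF assms] assms by (simp add: ennreal_plus)
  ultimately show ?thesis
    by (simp add: suminf_add)
qed

theorem theorem4p2:
  fixes m2 m3 m4 :: nat
  assumes "m2 \<ge> 1" and "m3 \<ge> 1" and "m4 \<ge> 1"
  shows "amzv ([-1, -1] @ ones (m2 - 1) @ [2] @ ones (m3 - 1) @ [2] @ ones (m4 - 1)) =
      amzv ([-1, -1] @ ones (m4 - 1) @ [-1, -1] @ ones (m3 - 1) @ [-1, -1] @ ones (m2 - 1))
      + amzv ([-1, -1] @ ones (m2 + m3 + m4 + 1))
      - amzv ([-1, -1] @ ones (m3 + m4) @ [-1, -1] @ ones (m2 - 1))
      - amzv ([-1, -1] @ ones (m4 - 1) @ [-1, -1] @ ones (m2 + m3))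
      + amzv ([-1, -1] @ ones (m2 - 1) @ [2] @ ones (m3 - 1)) * amzv [int m4 + 1]
      - amzv ([-1, -1] @ ones (m2 - 1))
        * (amzv [int m3 + int m4 + 2] + amzv [int m3 + 1, int m4 + 1])"
proof -
  \<comment> \<open>This removes the truncated subtractions from the list lengths.\<close>
  obtain n2 n3 n4 where m: "m2 = Suc n2" "m3 = Suc n3" "m4 = Suc n4"
    using assms by (metis Suc_pred' One_nat_def less_eq_Suc_le)
  \<comment> \<open>Only a carries a power of 2: it belongs to the block of m2, which is outermost
    on the left-hand side. In the reversed lists the powers of 2 telescope and leave 2^(-n) at the
    innermost index.\<close>
  define a where "a n = ennreal (1 / 2 ^ n) * inv_pow (1 + Suc n2) n" for n
  define b where "b = inv_pow (1 + Suc n3)"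
  define d where "d = inv_pow (1 + Suc n4)"
  \<comment> \<open>The signs make every abbreviation nonnegative: minus for an even number of pairs
    -1, -1 after the leading one, plus for an odd number.\<close>
  define X where "X = - amzv (- 1 # - 1 # ones n2 @ 2 # ones n3 @ 2 # ones n4)"
  define Y where "Y = - amzv (- 1 # - 1 # ones n2 @ 2 # ones n3)"
  define S where "S = - amzv (- 1 # - 1 # ones n2)"
  define T1 where "T1 = - amzv (- 1 # - 1 # ones n4 @ - 1 # - 1 # ones n3 @ - 1 # - 1 # ones n2)"
  define T2 where "T2 = - amzv (- 1 # - 1 # ones (Suc (Suc (Suc (Suc (n2 + n3 + n4))))))"
  define T3 where "T3 = amzv (- 1 # - 1 # ones (n3 + n4 + 2) @ - 1 # - 1 # ones n2)"
  define T4 where "T4 = amzv (- 1 # - 1 # ones n4 @ - 1 # - 1 # ones (n2 + n3 + 2))"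
  define z where "z = amzv [int (n4 + 2)]"
  define G where "G = amzv [int (n3 + 2) + int (n4 + 2)] + amzv [int (n3 + 2), int (n4 + 2)]"
  \<comment> \<open>This instance of commutativity moves 2^k outwards, where it meets the 2^(-k) of
    the enclosing sum.\<close>
  have comm: "inv_pow p k * (ennreal (2 ^ k) * y) = ennreal (2 ^ k) * (inv_pow p k * y)" for p k y
    by (rule mult.left_commute)
  note simps = inv_pow_mult inv_pow_mult_left half_pow_cancel comm
  have a: "a = (\<lambda>n. ennreal (1 / 2 ^ n) * inv_pow (1 + Suc n2) n)"
    by (simp add: a_def fun_eq_iff)
  have db: "d l * b l = inv_pow (1 + Suc (n3 + n4 + 2)) l" for l
    unfolding b_def d_def inv_pow_mult by (simp add: add_ac)
  have ba: "b k * a k = ennreal (1 / 2 ^ k) * inv_pow (1 + Suc (n2 + n3 + 2)) k" for k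
    unfolding b_def a_def mult.left_commute[of "inv_pow _ k"] inv_pow_mult by (simp add: add_ac)
  have dba: "d l * b l * a l = ennreal (1 / 2 ^ l) * inv_pow (1 + Suc (Suc (Suc (Suc (Suc (n2 + n3 + n4)))))) l" for l
    unfolding db a_def mult.left_commute[of "inv_pow _ l"] inv_pow_mult
    by (rule arg_cong[where f = "\<lambda>p. ennreal (1 / 2 ^ l) * inv_pow p l"]) simp
  have X: "ennreal X = (\<Sum>n. a n * tail_sum (\<lambda>k. b k * tail_sum d k) n)" "0 \<le> X"
    using amzv_minus_one_minus_one[OF laplace_rep_ones_2[OF laplace_rep_ones_2[OF laplace_rep_ones]], of n2 n3 n4]
    unfolding simps X_def a b_def d_def by (simp_all add: mult.assoc)
  have Y: "ennreal Y = (\<Sum>n. a n * tail_sum b n)" "0 \<le> Y"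
    using amzv_minus_one_minus_one[OF laplace_rep_ones_2[OF laplace_rep_ones], of n2 n3]
    unfolding simps Y_def a b_def by (simp_all add: mult.assoc)
  have S: "ennreal S = (\<Sum>n. a n)" "0 \<le> S"
    using amzv_minus_one_minus_one[OF laplace_rep_ones, of n2]
    unfolding simps S_def a by simp_all
  have T1: "ennreal T1 = (\<Sum>l. d l * tail_sum (\<lambda>k. b k * tail_sum a k) l)" "0 \<le> T1"
    using amzv_minus_one_minus_one[OF laplace_rep_ones_minus_one_minus_one[OF
        laplace_rep_ones_minus_one_minus_one[OF laplace_rep_ones]], of n4 n3 n2]
    unfolding simps T1_def a b_def d_def by simp_all
  have T2: "ennreal T2 = (\<Sum>l. d l * b l * a l)" "0 \<le> T2"
    using amzv_minus_one_minus_one[OF laplace_rep_ones, of "Suc (Suc (Suc (Suc (n2 + n3 + n4))))"]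
    unfolding simps T2_def dba by simp_all
  have T3: "ennreal T3 = (\<Sum>l. d l * b l * tail_sum a l)" "0 \<le> T3"
    using amzv_minus_one_minus_one[OF laplace_rep_ones_minus_one_minus_one[OF laplace_rep_ones], of "n3 + n4 + 2" n2]
    unfolding simps T3_def db a by simp_all
  have T4: "ennreal T4 = (\<Sum>l. d l * tail_sum (\<lambda>k. b k * a k) l)" "0 \<le> T4"
    using amzv_minus_one_minus_one[OF laplace_rep_ones_minus_one_minus_one[OF laplace_rep_ones], of n4 "n2 + n3 + 2"]
    unfolding simps T4_def ba d_def by simp_all
  have z: "ennreal z = (\<Sum>l. d l)" "0 \<le> z"
    using amzv_single[of "n4 + 2"] by (simp_all add: z_def d_def)
  have G: "ennreal G = (\<Sum>k. b k * (\<Sum>l\<le>k. d l))" "0 \<le> G"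
    using amzv_star[of "n3 + 2" "n4 + 2"] amzv_single(2)[of "n3 + 2 + (n4 + 2)"] amzv_double(2)[of "n3 + 2" "n4 + 2"]
    by (simp_all add: G_def b_def d_def)
  have "ennreal X + ennreal S * ennreal G
      = (ennreal T1 + ennreal T2 + ennreal T3 + ennreal T4) + ennreal Y * ennreal z"
    unfolding X S G T1 T2 T3 T4 Y z triple_sum_inclusion_exclusion triple_sum_reverse ..
  \<comment> \<open>All quantities are nonnegative, so the identity descends from
    \<open>ennreal\<close> to the reals.\<close>
  then have "ennreal (X + S * G) = ennreal (T1 + T2 + T3 + T4 + Y * z)"
    using X(2) Y(2) S(2) G(2) T1(2) T2(2) T3(2) T4(2) z(2) by (simp add: ennreal_mult ennreal_plus)
  then have "X + S * G = T1 + T2 + T3 + T4 + Y * z"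
    using X(2) Y(2) S(2) G(2) T1(2) T2(2) T3(2) T4(2) z(2) by (subst (asm) ennreal_inj) auto
  then show ?thesis
    by (simp add: m X_def Y_def S_def T1_def T2_def T3_def T4_def z_def G_def algebra_simps)
qed

end
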